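(* Let $A$ and $S$ be finite, non-empty subsets of an abelian group such that $S$ is independent. Write $n:=|S|$ and $d:=\min\{\operatorname{ord} s: s\in S\}$. If $\partial_S(A)\le(1-\gamma)n|A|$ for some real $\gamma\in(0,1]$, then $$|A|\ge 4^{(1-1/d)\gamma n}.$$ (If all elements of $S$ have infinite order, so that $d=\infty$, the conclusion is read with $1/d=0$, i.e. $|A|\ge 4^{\gamma n}$.)
   Context: $\partial_S(A)=|\{(a,s)\in A\times S: a+s\notin A\}|$. A finite subset $S$ of an abelian group is independent if for every integer-valued function $k$ on $S$, $\sum_{s\in S}k(s)s\ne 0$ unless all summands $k(s)s$ equal $0$ (i.e. the sum $\bigoplus_{s\in S}\langle s\rangle$ is direct). $\operatorname{ord} s$ denotes the order of $s$ (possibly infinite). *)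

theory Defs
  imports "HOL-Algebra.Algebra" "HOL-Library.Extended_Real"
begin

text \<open>
  The ambient abelian group is an arbitrary \<^locale>\<open>comm_group\<close>, written multiplicatively as in
  HOL-Algebra: \<open>a \<otimes> s\<close> stands for $a + s$ and \<open>s [^] k\<close> for $k s$.
\<close>

definition boundary_size :: "('a, 'm) monoid_scheme \<Rightarrow> 'a set \<Rightarrow> 'a set \<Rightarrow> nat" where
  "boundary_size G S A = card {(a, s). a \<in> A \<and> s \<in> S \<and> a \<otimes>\<^bsub>G\<^esub> s \<notin> A}"

definition group_independent :: "('a, 'm) monoid_scheme \<Rightarrow> 'a set \<Rightarrow> bool" where
  "group_independent G S \<longleftrightarrow>
     finite S \<and> S \<subseteq> carrier G \<and>
     (\<forall>k :: 'a \<Rightarrow> int.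
        finprod G (\<lambda>s. s [^]\<^bsub>G\<^esub> k s) S = \<one>\<^bsub>G\<^esub> \<longrightarrow>
        (\<forall>s\<in>S. s [^]\<^bsub>G\<^esub> k s = \<one>\<^bsub>G\<^esub>))"

text \<open>
  \<^const>\<open>group.ord\<close> is \<open>0\<close> on elements of infinite order; here these get order \<open>\<infinity>\<close>,
  so that minima over elements are correct.
\<close>

definition eord :: "('a, 'm) monoid_scheme \<Rightarrow> 'a \<Rightarrow> enat" where
  "eord G s = (if group.ord G s = 0 then \<infinity> else enat (group.ord G s))"

end

theory Submission
  imports Defs
begin

text \<open>
  Let \<open>X\<close> be uniform on \<open>A\<close>. The entropy of \<open>X\<close> is at least the sum over \<open>s \<in> S\<close> of its
  conditional entropies given the coset of \<open>\<langle>s\<rangle>\<close> containing \<open>X\<close>; this uses independence of \<open>S\<close>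
  and follows by induction on \<open>S\<close> from \<open>ln x \<le> x - 1\<close>. On the other hand, a set of \<open>k\<close> points in a
  coset of \<open>\<langle>s\<rangle>\<close> spans at most \<open>k - 1\<close> edges in direction \<open>s\<close>, unless it is the whole coset and
  \<open>k = ord s \<ge> d\<close>. Either way the number of edges is at most \<open>k log\<^sub>2 k / (2 (1 - 1/d))\<close>, and summing over
  all cosets and all \<open>s\<close> bounds the number \<open>n |A| - \<partial>\<^sub>S(A) \<ge> \<gamma> n |A|\<close> of edges inside \<open>A\<close>.
\<close>

section \<open>Entropy inequalities for labelled finite sets\<close>

text \<open>For \<open>X\<close> uniform on \<open>A\<close>, the two sums are \<open>card A\<close>
  times the entropies of \<open>X\<close> conditioned on \<open>f X\<close> and on
  \<open>g X\<close>. As the two labels together determine \<open>X\<close>, this is subadditivity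
  of entropy for the pair of labels, rearranged.\<close>

lemma two_partitions_entropy:
  assumes "finite A"
    and sep: "\<And>a b. a \<in> A \<Longrightarrow> b \<in> A \<Longrightarrow> f a = f b \<Longrightarrow> g a = g b \<Longrightarrow> a = b"
  shows "(\<Sum>a\<in>A. ln (real (card {b \<in> A. f b = f a}))) + (\<Sum>a\<in>A. ln (real (card {b \<in> A. g b = g a})))
           \<le> real (card A) * ln (real (card A))"
proof (cases "A = {}")
  case False
  define p where "p a = card {b \<in> A. f b = f a}" for a
  define q where "q a = card {b \<in> A. g b = g a}" for a
  define N where "N = card A"
  have pos: "0 < p a" "0 < q a" if "a \<in> A" for a
    using that \<open>finite A\<close> unfolding p_def q_def by (auto simp: card_gt_0_iff)
  have N: "0 < N" using False \<open>finite A\<close> by (auto simp: N_def card_gt_0_iff)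
  \<comment> \<open>Triples \<open>(a, b, c)\<close> with \<open>f b = f a\<close> and
    \<open>g c = g a\<close>. The pair \<open>(b, c)\<close> fixes both labels of \<open>a\<close>,
    hence \<open>a\<close> itself, so there are at most \<open>N * N\<close> triples.\<close>
  let ?T = "SIGMA a:A. {b \<in> A. f b = f a} \<times> {b \<in> A. g b = g a}"
  have "inj_on snd ?T"
  proof (rule inj_onI)
    fix x y assume "x \<in> ?T" "y \<in> ?T" "snd x = snd y"
    then show "x = y" using sep[of "fst x" "fst y"] by (cases x; cases y) auto
  qed
  moreover have "snd ` ?T \<subseteq> A \<times> A" by auto
  ultimately have "card ?T \<le> N * N"
    using card_inj_on_le[of snd ?T "A \<times> A"] \<open>finite A\<close> by (simp add: N_def card_cartesian_product)
  moreover have "card ?T = (\<Sum>a\<in>A. p a * q a)"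
    using \<open>finite A\<close> by (subst card_SigmaI) (auto simp: p_def q_def card_cartesian_product)
  ultimately have "(\<Sum>a\<in>A. p a * q a) \<le> N * N" by simp
  then have le: "(\<Sum>a\<in>A. real (p a) * real (q a)) \<le> real N * real N"
    by (metis (mono_tags, lifting) of_nat_le_iff of_nat_mult of_nat_sum sum.cong)
  \<comment> \<open>Summed over \<open>A\<close>, the right-hand side is at most 0 because the
    average of \<open>p a * q a / N\<close> is at most 1.\<close>
  have "ln (real (p a)) + ln (real (q a)) - ln (real N) \<le> real (p a) * real (q a) / real N - 1"
    if "a \<in> A" for a
    using ln_le_minus_one[of "real (p a) * real (q a) / real N"] pos[OF that] N
    by (simp add: ln_mult ln_div)
  then have "(\<Sum>a\<in>A. ln (real (p a)) + ln (real (q a)) - ln (real N))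
      \<le> (\<Sum>a\<in>A. real (p a) * real (q a) / real N - 1)"
    by (rule sum_mono)
  also have "\<dots> = (\<Sum>a\<in>A. real (p a) * real (q a)) / real N - real N"
    by (simp add: sum_subtractf sum_divide_distrib N_def)
  also have "\<dots> \<le> 0" using le N by (simp add: field_simps)
  finally show ?thesis
    by (simp add: sum_subtractf sum.distrib p_def q_def N_def)
qed simp

text \<open>In the application \<open>F U a\<close> is the coset of \<open>a\<close> modulo the
  subgroup generated by \<open>U\<close>. The induction on \<open>T\<close> keeps \<open>A\<close>
  arbitrary, since its hypothesis is applied inside each fibre of \<open>F T\<close>.\<close>

lemma fibre_entropy:
  fixes F :: "'i set \<Rightarrow> 'a \<Rightarrow> 'b"
  assumes "finite T" "finite A"
    and mono: "\<And>i U a b. U \<subseteq> T \<Longrightarrow> i \<in> U \<Longrightarrow> a \<in> A \<Longrightarrow> b \<in> A \<Longrightarrow> F {i} a = F {i} b \<Longrightarrow> F U a = F U b"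
    and sep: "\<And>i U a b. insert i U \<subseteq> T \<Longrightarrow> i \<notin> U \<Longrightarrow> a \<in> A \<Longrightarrow> b \<in> A \<Longrightarrow>
                F {i} a = F {i} b \<Longrightarrow> F U a = F U b \<Longrightarrow> a = b"
  shows "(\<Sum>i\<in>T. \<Sum>a\<in>A. ln (real (card {b \<in> A. F {i} b = F {i} a}))) \<le> real (card A) * ln (real (card A))"
  using assms
proof (induction T arbitrary: A rule: finite_induct)
  case empty
  then show ?case by (cases "card A") auto
next
  case (insert i T)
  let ?fib = "\<lambda>y. {a \<in> A. F T a = y}"
  have 1: "(\<Sum>j\<in>T. \<Sum>a\<in>?fib y. ln (real (card {b \<in> ?fib y. F {j} b = F {j} a})))
        \<le> real (card (?fib y)) * ln (real (card (?fib y)))" for y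
  proof (rule insert.IH)
    show "F U a = F U b" if "U \<subseteq> T" "j \<in> U" "a \<in> ?fib y" "b \<in> ?fib y" "F {j} a = F {j} b" for j U a b
      by (rule insert.prems(2)[of U j]) (use that in auto)
    show "a = b" if "Set.insert j U \<subseteq> T" "j \<notin> U" "a \<in> ?fib y" "b \<in> ?fib y" "F {j} a = F {j} b"
      "F U a = F U b" for j U a b
      by (rule insert.prems(3)[of j U]) (use that in auto)
    show "finite (?fib y)" using insert.prems(1) by simp
  qed
  \<comment> \<open>By \<open>mono\<close>, each class of \<open>F {j}\<close> with \<open>j\<close>
    in \<open>T\<close> lies inside one fibre of \<open>F T\<close>, so its size is the same whether
    counted in the fibre or in \<open>A\<close>.\<close>
  have fib: "{b \<in> ?fib (F T a). F {j} b = F {j} a} = {b \<in> A. F {j} b = F {j} a}"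
    if "a \<in> A" "j \<in> T" for a j
  proof -
    have "F T b = F T a" if "b \<in> A" "F {j} b = F {j} a" for b
      by (rule insert.prems(2)[of T j]) (use that \<open>a \<in> A\<close> \<open>j \<in> T\<close> in auto)
    then show ?thesis by blast
  qed
  have split: "(\<Sum>a\<in>A. h a) = (\<Sum>y\<in>F T ` A. \<Sum>a\<in>?fib y. h a)" for h :: "'a \<Rightarrow> real"
    using sum.group[of A "F T ` A" "F T" h] insert.prems(1) by simp
  have "(\<Sum>a\<in>A. ln (real (card {b \<in> A. F {j} b = F {j} a})))
      = (\<Sum>y\<in>F T ` A. \<Sum>a\<in>?fib y. ln (real (card {b \<in> ?fib y. F {j} b = F {j} a})))"
    if j: "j \<in> T" for j
  proof (subst split, intro sum.cong refl)
    fix y a assume "a \<in> ?fib y"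
    then have a: "a \<in> A" "y = F T a" by auto
    show "ln (real (card {b \<in> A. F {j} b = F {j} a}))
        = ln (real (card {b \<in> ?fib y. F {j} b = F {j} a}))"
      unfolding a(2) fib[OF a(1) j] ..
  qed
  then have "(\<Sum>j\<in>T. \<Sum>a\<in>A. ln (real (card {b \<in> A. F {j} b = F {j} a})))
      = (\<Sum>j\<in>T. \<Sum>y\<in>F T ` A. \<Sum>a\<in>?fib y. ln (real (card {b \<in> ?fib y. F {j} b = F {j} a})))"
    by (rule sum.cong[OF refl])
  also have "\<dots> = (\<Sum>y\<in>F T ` A. \<Sum>j\<in>T. \<Sum>a\<in>?fib y. ln (real (card {b \<in> ?fib y. F {j} b = F {j} a})))"
    by (rule sum.swap)
  also have "\<dots> \<le> (\<Sum>y\<in>F T ` A. real (card (?fib y)) * ln (real (card (?fib y))))"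
    by (intro sum_mono 1)
  also have "\<dots> = (\<Sum>a\<in>A. ln (real (card {b \<in> A. F T b = F T a})))"
    by (subst split, intro sum.cong refl) simp
  finally have "(\<Sum>j\<in>T. \<Sum>a\<in>A. ln (real (card {b \<in> A. F {j} b = F {j} a})))
      \<le> (\<Sum>a\<in>A. ln (real (card {b \<in> A. F T b = F T a})))" .
  \<comment> \<open>The new index contributes the partition by \<open>F {i}\<close>, which together
    with the partition by \<open>F T\<close> separates points by \<open>sep\<close>.\<close>
  moreover have "(\<Sum>a\<in>A. ln (real (card {b \<in> A. F {i} b = F {i} a})))
      + (\<Sum>a\<in>A. ln (real (card {b \<in> A. F T b = F T a}))) \<le> real (card A) * ln (real (card A))"
  proof (rule two_partitions_entropy)
    show "finite A" by fact
    show "a = b" if "a \<in> A" "b \<in> A" "F {i} a = F {i} b" "F T a = F T b" for a b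
      by (rule insert.prems(3)[of i T]) (use that insert.hyps in auto)
  qed
  ultimately show ?case
    using insert.hyps by simp
qed

section \<open>Edges in one direction inside a finite set\<close>

text \<open>This is where the base 4 arises: \<open>2 * ln 2\<close> is \<open>ln 4\<close>, and
  equality holds at \<open>k = 1\<close> and \<open>k = 2\<close>.\<close>

lemma ln_ge_two_ln_2:
  assumes "1 \<le> k"
  shows "2 * ln 2 * (1 - 1 / real k) \<le> ln (real k)"
proof (cases "k = 1")
  case False
  then have k: "2 \<le> real k" using assms by simp
  \<comment> \<open>This gives \<open>ln k\<close> at least \<open>ln 2 + (1 - 2 / k)\<close>,
    whereas the target is \<open>ln 2 + ln 2 * (1 - 2 / k)\<close>; the difference is the
    nonnegative product below.\<close>
  have "ln (2 / real k) \<le> 2 / real k - 1"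
    using k by (intro ln_le_minus_one) simp
  then have "ln 2 + (1 - 2 / real k) \<le> ln (real k)" using k by (simp add: ln_div)
  moreover have "0 \<le> (1 - ln 2) * (1 - 2 / real k)"
    using k ln_le_minus_one[of 2] by (intro mult_nonneg_nonneg) (auto simp: field_simps)
  ultimately show ?thesis by (simp add: algebra_simps diff_divide_distrib)
qed simp

context comm_group
begin

text \<open>Starting at any \<open>b\<close> in \<open>B\<close>, repeated multiplication by
  \<open>s\<close> stays in \<open>B\<close> and visits \<open>ord s\<close> distinct
  points.\<close>

lemma ord_le_card_closed:
  assumes s: "s \<in> carrier G" and B: "finite B" "B \<noteq> {}" "B \<subseteq> carrier G"
    and closed: "\<And>b. b \<in> B \<Longrightarrow> b \<otimes> s \<in> B"
  shows "0 < ord s" "ord s \<le> card B"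
proof -
  obtain b where b: "b \<in> B" using B by auto
  then have bc: "b \<in> carrier G" using B by auto
  have mem: "b \<otimes> s [^] (k::nat) \<in> B" for k
  proof (induction k)
    case (Suc k)
    then show ?case using closed[of "b \<otimes> s [^] k"] s bc by (simp add: m_assoc)
  qed (use b bc in simp)
  \<comment> \<open>For finite order \<open>N = ord s\<close> is used. Infinite order means
    \<open>ord s = 0\<close>, which divides no positive \<open>k\<close>, so even
    \<open>N = Suc (card B)\<close> qualifies, a contradiction.\<close>
  have le: "N \<le> card B" if N: "\<And>k. 0 < k \<Longrightarrow> k < N \<Longrightarrow> \<not> ord s dvd k" for N
  proof -
    have *: False if "i < j" "j < N" "b \<otimes> s [^] i = b \<otimes> s [^] j" for i j :: nat
    proof -
      have "s [^] j = s [^] i \<otimes> s [^] (j - i)" using that s by (simp add: nat_pow_mult)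
      then have "s [^] (j - i) = \<one>" using that s bc by simp
      then show False using N[of "j - i"] that s by (simp add: pow_eq_id)
    qed
    have "inj_on (\<lambda>k. b \<otimes> s [^] k) {..<N}"
    proof (rule inj_onI)
      fix i j assume "i \<in> {..<N}" "j \<in> {..<N}" "b \<otimes> s [^] i = b \<otimes> s [^] j"
      then show "i = j" using *[of i j] *[of j i] by (cases i j rule: linorder_cases) auto
    qed
    then show ?thesis
      using card_inj_on_le[of "\<lambda>k. b \<otimes> s [^] k" "{..<N}" B] mem B by auto
  qed
  show "0 < ord s" using le[of "Suc (card B)"] by (cases "ord s = 0") auto
  show "ord s \<le> card B" by (rule le) (auto dest: dvd_imp_le)
qed

text \<open>If \<open>B\<close> is closed under multiplication by \<open>s\<close>, it has
  \<open>k = card B\<close> edges, but then \<open>k\<close> is at least \<open>ord s\<close> and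
  \<theta> is at most \<open>1 - 1 / k\<close>. Otherwise some edge leaves \<open>B\<close>, so at
  most \<open>k - 1 = (1 - 1 / k) * k\<close> remain and \<theta> is bounded by 1. Both cases end in
  \<open>ln_ge_two_ln_2\<close>.\<close>

lemma edges_in_coset:
  assumes s: "s \<in> carrier G" and B: "finite B" "B \<subseteq> carrier G"
    and \<theta>: "0 \<le> \<theta>" "\<theta> \<le> 1" "0 < ord s \<Longrightarrow> \<theta> \<le> 1 - 1 / real (ord s)"
  shows "2 * ln 2 * \<theta> * real (card {a \<in> B. a \<otimes> s \<in> B}) \<le> real (card B) * ln (real (card B))"
proof (cases "B = {}")
  case False
  define k where "k = card B"
  have k: "1 \<le> k" using False B by (simp add: k_def Suc_le_eq card_gt_0_iff)
  show ?thesis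
  proof (cases "\<forall>b\<in>B. b \<otimes> s \<in> B")
    case True
    then have ord: "0 < ord s" "ord s \<le> k"
      using ord_le_card_closed[OF s] B False unfolding k_def by auto
    have "\<theta> \<le> 1 - 1 / real (ord s)" using \<theta> ord by simp
    also have "\<dots> \<le> 1 - 1 / real k" using ord by (simp add: frac_le)
    finally have "2 * ln 2 * \<theta> \<le> 2 * ln 2 * (1 - 1 / real k)" by simp
    also have "\<dots> \<le> ln (real k)" by (rule ln_ge_two_ln_2[OF k])
    finally have "2 * ln 2 * \<theta> * real k \<le> ln (real k) * real k" by (rule mult_right_mono) simp
    moreover have "{a \<in> B. a \<otimes> s \<in> B} = B" using True by auto
    ultimately show ?thesis by (simp add: k_def mult.commute)
  next
    case False
    then have "{a \<in> B. a \<otimes> s \<in> B} \<subset> B" by auto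
    then have "card {a \<in> B. a \<otimes> s \<in> B} < k" unfolding k_def using B by (intro psubset_card_mono)
    then have e: "real (card {a \<in> B. a \<otimes> s \<in> B}) \<le> real k - 1" by simp
    have "\<theta> * real (card {a \<in> B. a \<otimes> s \<in> B}) \<le> 1 * (real k - 1)"
      using \<theta> e k by (intro mult_mono) auto
    then have "2 * ln 2 * \<theta> * real (card {a \<in> B. a \<otimes> s \<in> B}) \<le> 2 * ln 2 * (real k - 1)"
      by (simp add: mult.assoc)
    also have "\<dots> = 2 * ln 2 * (1 - 1 / real k) * real k" using k by (simp add: field_simps)
    also have "\<dots> \<le> ln (real k) * real k" by (intro mult_right_mono ln_ge_two_ln_2 k) simp
    finally show ?thesis by (simp add: k_def mult.commute)
  qed
qed simp

section \<open>Independence and the cosets of generated subgroups\<close>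

lemma generate_as_finprod:
  assumes T: "finite T" "T \<subseteq> carrier G" and x: "x \<in> generate G T"
  obtains k :: "'a \<Rightarrow> int" where "x = finprod G (\<lambda>t. t [^] k t) T"
proof -
  have c: "(\<lambda>t. t [^] (k t :: int)) \<in> T \<rightarrow> carrier G" for k using T by auto
  have delta: "h [^] j = finprod G (\<lambda>t. t [^] (if h = t then j else 0)) T" if "h \<in> T" for h and j :: int
  proof -
    have "finprod G (\<lambda>t. t [^] (if h = t then j else 0)) T
        = finprod G (\<lambda>t. if h = t then t [^] j else \<one>) T"
      using T that by (intro finprod_cong') auto
    also have "\<dots> = h [^] j" using that T by (intro finprod_singleton) auto
    finally show ?thesis by simp
  qed
  have "\<exists>k :: 'a \<Rightarrow> int. x = finprod G (\<lambda>t. t [^] k t) T"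
    using x
  proof (induction rule: generate.induct)
    case one
    show ?case by (rule exI[of _ "\<lambda>_. 0"]) simp
  next
    case (incl h)
    then have "h [^] (1::int) = h" using T by (auto simp: int_pow_1)
    with delta[OF incl, of 1] show ?case by metis
  next
    case (inv h)
    then have "h [^] (- 1::int) = inv h" using T by (auto simp: int_pow_neg int_pow_1)
    with delta[OF inv, of "- 1"] show ?case by metis
  next
    case (eng x y)
    then obtain k l :: "'a \<Rightarrow> int" where
      "x = finprod G (\<lambda>t. t [^] k t) T" "y = finprod G (\<lambda>t. t [^] l t) T" by blast
    then have "x \<otimes> y = finprod G (\<lambda>t. t [^] k t \<otimes> t [^] l t) T" using c by simp
    also have "\<dots> = finprod G (\<lambda>t. t [^] (k t + l t)) T"
      using T by (intro finprod_cong') (auto simp: int_pow_mult subset_iff)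
    finally show ?case by (intro exI[of _ "\<lambda>t. k t + l t"])
  qed
  then show thesis using that by blast
qed

text \<open>Write \<open>x\<close> as a power of \<open>s\<close> and as a product of powers over
  \<open>T\<close>. The quotient of the two is a relation on \<open>S\<close>, so independence makes
  its \<open>s\<close>-term trivial.\<close>

lemma independent_generate_Int:
  assumes ind: "group_independent G S" and sub: "insert s T \<subseteq> S" and "s \<notin> T"
    and x: "x \<in> generate G {s}" "x \<in> generate G T"
  shows "x = \<one>"
proof -
  have S: "finite S" "S \<subseteq> carrier G" using ind by (auto simp: group_independent_def)
  have T: "finite T" "T \<subseteq> carrier G" and s: "s \<in> carrier G" using S sub finite_subset[of T S] by auto
  obtain j :: int where j: "x = s [^] j" using x(1) generate_pow[OF s] by auto
  obtain k :: "'a \<Rightarrow> int" where k: "x = finprod G (\<lambda>t. t [^] k t) T"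
    using generate_as_finprod[OF T x(2)] .
  define l where "l t = (if t = s then - j else if t \<in> T then k t else 0)" for t
  have "finprod G (\<lambda>t. t [^] l t) S = finprod G (\<lambda>t. t [^] l t) (insert s T)"
    using S sub by (intro finprod_mono_neutral_cong_right) (auto simp: l_def)
  also have "\<dots> = s [^] l s \<otimes> finprod G (\<lambda>t. t [^] l t) T"
    using T s \<open>s \<notin> T\<close> by (intro finprod_insert) auto
  also have "finprod G (\<lambda>t. t [^] l t) T = x"
    unfolding k using T \<open>s \<notin> T\<close> by (intro finprod_cong') (auto simp: l_def)
  also have "s [^] l s \<otimes> x = \<one>" using s by (simp add: l_def j int_pow_neg)
  finally have "finprod G (\<lambda>t. t [^] l t) S = \<one>" .
  moreover have "finprod G (\<lambda>t. t [^] l t) S = \<one> \<longrightarrow> (\<forall>t\<in>S. t [^] l t = \<one>)"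
    using ind unfolding group_independent_def by (elim conjE allE)
  ultimately have "s [^] l s = \<one>" using sub by simp
  then show ?thesis using s j by (simp add: l_def int_pow_neg inv_eq_1_iff)
qed

lemma rcos_eq_iff:
  assumes "subgroup H G" "a \<in> carrier G" "b \<in> carrier G"
  shows "H #> a = H #> b \<longleftrightarrow> a \<otimes> inv b \<in> H"
proof -
  have "H #> a = H #> b \<longleftrightarrow> a \<in> H #> b"
    using repr_independence[OF _ assms(3,1)] repr_independenceD[OF assms(1,2)]
      rcos_self[OF assms(2,1)] by blast
  also have "\<dots> \<longleftrightarrow> a \<otimes> inv b \<in> H"
    using subgroup.rcos_module[OF assms(1) is_group assms(3,2)] .
  finally show ?thesis .
qed

text \<open>Cosets of larger subgroups are coarser, which is \<open>mono\<close>; two elements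
  sharing a coset of both subgroups differ by an element of a trivial intersection, which is
  \<open>sep\<close>.\<close>

lemma independent_entropy:
  assumes ind: "group_independent G S" and A: "finite A" "A \<subseteq> carrier G"
  shows "(\<Sum>s\<in>S. \<Sum>a\<in>A. ln (real (card {b \<in> A. generate G {s} #> b = generate G {s} #> a})))
           \<le> real (card A) * ln (real (card A))"
proof (rule fibre_entropy[where F = "\<lambda>U a. generate G U #> a"])
  have S: "finite S" "S \<subseteq> carrier G" using ind by (auto simp: group_independent_def)
  have sg: "subgroup (generate G U) G" if "U \<subseteq> S" for U
    using that S by (intro generate_is_subgroup) auto
  show "finite S" "finite A" by fact+
  show "generate G U #> a = generate G U #> b"
    if "U \<subseteq> S" "s \<in> U" "a \<in> A" "b \<in> A" "generate G {s} #> a = generate G {s} #> b" for s U a b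
  proof -
    have c: "a \<in> carrier G" "b \<in> carrier G" "{s} \<subseteq> S" using that A by auto
    have "a \<otimes> inv b \<in> generate G {s}"
      using rcos_eq_iff[OF sg[OF c(3)] c(1,2)] that(5) by simp
    moreover have "generate G {s} \<subseteq> generate G U" using that by (intro mono_generate) auto
    ultimately show ?thesis using rcos_eq_iff[OF sg[OF that(1)] c(1,2)] by auto
  qed
  show "a = b"
    if "insert s U \<subseteq> S" "s \<notin> U" "a \<in> A" "b \<in> A" "generate G {s} #> a = generate G {s} #> b"
      "generate G U #> a = generate G U #> b" for s U a b
  proof -
    have c: "a \<in> carrier G" "b \<in> carrier G" "{s} \<subseteq> S" "U \<subseteq> S" using that A by auto
    have "a \<otimes> inv b \<in> generate G {s}" "a \<otimes> inv b \<in> generate G U"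
      using rcos_eq_iff[OF sg[OF c(3)] c(1,2)] rcos_eq_iff[OF sg[OF c(4)] c(1,2)] that(5,6) by auto
    then have "a \<otimes> inv b = \<one>" using independent_generate_Int[OF ind that(1,2)] by blast
    then show ?thesis using c inv_equality[of a "inv b"] by simp
  qed
qed

section \<open>Counting edges and the final bound\<close>

text \<open>Multiplication by \<open>s\<close> preserves the cosets of
  \<open>generate G {s}\<close>, so no edge joins two of them and \<open>edges_in_coset\<close> can
  be summed over the pieces of \<open>A\<close>.\<close>

lemma edges_in_direction:
  assumes s: "s \<in> carrier G" and A: "finite A" "A \<subseteq> carrier G"
    and \<theta>: "0 \<le> \<theta>" "\<theta> \<le> 1" "0 < ord s \<Longrightarrow> \<theta> \<le> 1 - 1 / real (ord s)"
  shows "2 * ln 2 * \<theta> * real (card {a \<in> A. a \<otimes> s \<in> A})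
     \<le> (\<Sum>a\<in>A. ln (real (card {b \<in> A. generate G {s} #> b = generate G {s} #> a})))"
proof -
  define f where "f a = generate G {s} #> a" for a
  let ?fib = "\<lambda>y. {a \<in> A. f a = y}"
  have sg: "subgroup (generate G {s}) G" using s by (intro generate_is_subgroup) auto
  have f: "f (a \<otimes> s) = f a" if "a \<in> A" for a
  proof -
    have "a \<in> carrier G" using that A by auto
    moreover have "a \<otimes> s \<otimes> inv a = s"
      using calculation s by (simp add: m_comm[of a s] m_assoc)
    moreover have "s \<in> generate G {s}" by (rule generate.incl) simp
    ultimately show ?thesis unfolding f_def using rcos_eq_iff[OF sg, of "a \<otimes> s" a] s by simp
  qed
  have split: "(\<Sum>a\<in>A. h a) = (\<Sum>y\<in>f ` A. \<Sum>a\<in>?fib y. h a)" for h :: "'a \<Rightarrow> real"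
    using sum.group[of A "f ` A" f h] A by simp
  have "real (card {a \<in> A. a \<otimes> s \<in> A}) = (\<Sum>a\<in>A. if a \<otimes> s \<in> A then 1 else 0)"
    using A by (simp add: sum.inter_filter[symmetric])
  also have "\<dots> = (\<Sum>y\<in>f ` A. real (card {a \<in> ?fib y. a \<otimes> s \<in> ?fib y}))"
  proof (subst split, intro sum.cong refl)
    fix y
    have "{a \<in> ?fib y. a \<otimes> s \<in> ?fib y} = {a \<in> ?fib y. a \<otimes> s \<in> A}" using f by auto
    then show "(\<Sum>a\<in>?fib y. if a \<otimes> s \<in> A then 1 else 0) = real (card {a \<in> ?fib y. a \<otimes> s \<in> ?fib y})"
      using A by (simp add: sum.inter_filter[symmetric])
  qed
  finally have "2 * ln 2 * \<theta> * real (card {a \<in> A. a \<otimes> s \<in> A})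
      = (\<Sum>y\<in>f ` A. 2 * ln 2 * \<theta> * real (card {a \<in> ?fib y. a \<otimes> s \<in> ?fib y}))"
    by (simp add: sum_distrib_left)
  also have "\<dots> \<le> (\<Sum>y\<in>f ` A. real (card (?fib y)) * ln (real (card (?fib y))))"
    using A by (intro sum_mono edges_in_coset[OF s _ _ \<theta>]) auto
  also have "\<dots> = (\<Sum>a\<in>A. ln (real (card {b \<in> A. f b = f a})))"
    by (subst split, intro sum.cong refl) simp
  finally show ?thesis by (simp add: f_def)
qed

lemma boundary_size_complement:
  assumes "finite A" "finite S"
  shows "boundary_size G S A + (\<Sum>s\<in>S. card {a \<in> A. a \<otimes> s \<in> A}) = card S * card A"
proof -
  let ?in = "{(a, s). a \<in> A \<and> s \<in> S \<and> a \<otimes> s \<in> A}" and ?out = "{(a, s). a \<in> A \<and> s \<in> S \<and> a \<otimes> s \<notin> A}"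
  have "finite ?in" "finite ?out"
    by (rule finite_subset[of _ "A \<times> S"], use assms in auto)+
  then have "card ?out + card ?in = card (?out \<union> ?in)" by (intro card_Un_disjoint[symmetric]) auto
  also have "?out \<union> ?in = A \<times> S" by auto
  finally have "card ?out + card ?in = card S * card A" by (simp add: card_cartesian_product)
  moreover have "card ?in = card (SIGMA s:S. {a \<in> A. a \<otimes> s \<in> A})"
    by (intro bij_betw_same_card[of "\<lambda>(a, s). (s, a)"] bij_betwI[where g = "\<lambda>(s, a). (a, s)"]) auto
  ultimately show ?thesis using assms by (simp add: boundary_size_def)
qed

end

theorem theorem1p6:
  fixes G :: "('a, 'm) monoid_scheme"
    and A S :: "'a set" and n :: nat and d :: enat and \<gamma> :: real
  assumes "comm_group G"
    and "A \<subseteq> carrier G" "finite A" "A \<noteq> {}"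
    and "S \<subseteq> carrier G" "finite S" "S \<noteq> {}"
    and "group_independent G S"
    and "n = card S"
    and "d = Min (eord G ` S)"
    and "0 < \<gamma>" "\<gamma> \<le> 1"
    and "real (boundary_size G S A) \<le> (1 - \<gamma>) * real n * real (card A)"
  shows "real (card A) \<ge> 4 powr ((1 - real_of_ereal (1 / ereal_of_enat d)) * \<gamma> * real n)"
proof -
  interpret comm_group G by fact
  \<comment> \<open>The factor \<open>1 - 1/d\<close>; it equals 1 for infinite \<open>d\<close>, as
    the extended-real quotient is then 0.\<close>
  define \<theta> where "\<theta> = 1 - real_of_ereal (1 / ereal_of_enat d)"
  have "d \<in> eord G ` S" unfolding \<open>d = _\<close> using assms by (intro Min_in) auto
  \<comment> \<open>The value 0 that \<open>ord\<close> gives to infinite order has been replaced by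
    infinity in \<open>eord\<close>, so the minimum is positive.\<close>
  then have "d \<noteq> 0" by (auto simp: eord_def zero_enat_def)
  have inv_d: "real_of_ereal (1 / ereal_of_enat (enat m)) = 1 / real m" if "0 < m" for m
    using that by (simp add: one_ereal_def)
  have \<theta>01: "0 \<le> \<theta>" "\<theta> \<le> 1"
    using \<open>d \<noteq> 0\<close> inv_d unfolding \<theta>_def by (cases d; force simp: zero_enat_def)+
  have \<theta>: "\<theta> \<le> 1 - 1 / real (ord s)" if "s \<in> S" "0 < ord s" for s
  proof -
    have "d \<le> eord G s" unfolding \<open>d = _\<close> using assms that by (intro Min_le) auto
    then have "d \<le> enat (ord s)" using that by (simp add: eord_def)
    then obtain m where m: "d = enat m" "m \<le> ord s" by (cases d) auto
    then show ?thesis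
      using \<open>d \<noteq> 0\<close> inv_d[of m] unfolding \<theta>_def by (simp add: zero_enat_def frac_le)
  qed
  \<comment> \<open>The number of edges inside \<open>A\<close>, that is, all \<open>n * N\<close>
    pairs minus the boundary; the hypothesis makes it at least \<gamma>
    \<open>* n * N\<close>.\<close>
  define e where "e = (\<Sum>s\<in>S. real (card {a \<in> A. a \<otimes>\<^bsub>G\<^esub> s \<in> A}))"
  define N where "N = real (card A)"
  have N: "0 < N" using assms by (simp add: N_def card_gt_0_iff)
  have "2 * ln 2 * \<theta> * e = (\<Sum>s\<in>S. 2 * ln 2 * \<theta> * real (card {a \<in> A. a \<otimes>\<^bsub>G\<^esub> s \<in> A}))"
    by (simp add: e_def sum_distrib_left)
  also have "\<dots> \<le> (\<Sum>s\<in>S. \<Sum>a\<in>A. ln (real (card {b \<in> A. generate G {s} #>\<^bsub>G\<^esub> b = generate G {s} #>\<^bsub>G\<^esub> a})))"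
    using assms by (intro sum_mono edges_in_direction \<theta>01 \<theta>) auto
  also have "\<dots> \<le> N * ln N" unfolding N_def by (intro independent_entropy assms)
  finally have upper: "2 * ln 2 * \<theta> * e \<le> N * ln N" .
  have "real (boundary_size G S A) + e = real n * N"
    using arg_cong[OF boundary_size_complement[OF \<open>finite A\<close> \<open>finite S\<close>], of real] \<open>n = card S\<close>
    by (simp add: e_def N_def)
  then have "\<gamma> * real n * N \<le> e" using assms(13) by (simp add: N_def algebra_simps)
  then have "2 * ln 2 * \<theta> * (\<gamma> * real n * N) \<le> 2 * ln 2 * \<theta> * e"
    using \<theta>01 by (intro mult_left_mono) auto
  with upper have "N * (2 * ln 2 * \<theta> * \<gamma> * real n) \<le> N * ln N" by (simp add: algebra_simps)
  then have "\<theta> * \<gamma> * real n * (2 * ln 2) \<le> ln N" using N by (simp add: algebra_simps)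
  moreover have "ln 4 = 2 * ln (2::real)" using ln_realpow[of 2 2] by simp
  ultimately have "4 powr (\<theta> * \<gamma> * real n) \<le> N" using N by (simp add: powr_def ln_ge_iff)
  then show ?thesis by (simp add: \<theta>_def N_def)
qed

end
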